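(* Let $\mathcal H$ be a finite-dimensional complex Hilbert space with a fixed computational (orthonormal) basis, let $\widetilde P:\mathcal L(\mathcal H)\to\mathcal L(\mathcal H)$ be a linear projector ($\widetilde P^2=\widetilde P$), let $\gamma\ne0$, and let $$\mathcal S=\{W\in\mathcal L(\mathcal H):\widetilde P[W]=W,\ \operatorname{tr}[W]=\gamma\}.$$ Then an operator $\overline W\in\mathcal L(\mathcal H)$ belongs to the dual affine set $\overline{\mathcal S}$ of $\mathcal S$ if and only if $$\widetilde P^\tau[\overline W^\tau]=\frac1\gamma\,\widetilde P^\tau[\mathbb 1],$$ where $\widetilde P^\tau[\overline W^\tau]:=\big(\widetilde P^\dagger[\overline W^\dagger]\big)^*$.
   Context: $\mathcal L(\mathcal H)$ is the space of linear operators on $\mathcal H$. The dual affine set $\overline{\mathcal S}$ of $\mathcal S\subseteq\mathcal L(\mathcal H)$ is the set of all $\overline W\in\mathcal L(\mathcal H)$ with $\operatorname{tr}[\overline W^\dagger W]=1$ for all $W\in\mathcal S$. The adjoint $\widetilde P^\dagger$ is defined by $\operatorname{tr}[B^\dagger\widetilde P[A]]=\operatorname{tr}[\widetilde P^\dagger[B]^\dagger A]$ for all $A,B\in\mathcal L(\mathcal H)$. $\widetilde P^\tau$ is the linear map $\widetilde P^\tau[A]:=\big(\widetilde P^\dagger[A^*]\big)^*$, where $*$ is entrywise complex conjugation in the computational basis. $\overline W^\tau$ is the transpose of $\overline W$ in the computational basis.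
   Formalization: S is assumed nonempty; the equation is shown equivalent to the adjoint of W̄ (not W̄ itself) lying in the dual affine set, and to W̄ lying in it when W̄ is Hermitian, or P̃ is Hermitian-preserving and γ real; as stated the claim is false. *)

theory Defs
  imports "HOL-Analysis.Analysis"
begin

text \<open>
  Operators on the Hilbert space with computational basis indexed by \<open>'n\<close> are represented
  by their matrices in that basis.
\<close>

type_synonym 'n operator = "complex ^ 'n ^ 'n"

definition conj_op :: "'n::finite operator \<Rightarrow> 'n operator" where
  "conj_op A = map_matrix cnj A"

definition dag :: "'n::finite operator \<Rightarrow> 'n operator" where
  "dag A = conj_op (transpose A)"

definition scale_op :: "complex \<Rightarrow> 'n::finite operator \<Rightarrow> 'n operator" where
  "scale_op c A = map_matrix ((*) c) A"

lemma conj_op_nth [simp]: "conj_op A $ i $ j = cnj (A $ i $ j)"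
  by (simp add: conj_op_def map_matrix_def)

lemma dag_nth [simp]: "dag A $ i $ j = cnj (A $ j $ i)"
  by (simp add: dag_def transpose_def)

lemma scale_op_nth [simp]: "scale_op c A $ i $ j = c * A $ i $ j"
  by (simp add: scale_op_def map_matrix_def)

text \<open>Plain \<open>linear\<close> on this type is only real-linearity.\<close>

abbreviation clinear_map :: "('n::finite operator \<Rightarrow> 'n operator) \<Rightarrow> bool" where
  "clinear_map \<equiv> Vector_Spaces.linear scale_op scale_op"

definition hermitian_preserving :: "('n::finite operator \<Rightarrow> 'n operator) \<Rightarrow> bool" where
  "hermitian_preserving P \<longleftrightarrow> (\<forall>A. P (dag A) = dag (P A))"

text \<open>The description below is well defined for complex-linear \<open>P\<close>; see \<open>adjoint_map\<close>.\<close>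

definition adjoint_map :: "('n::finite operator \<Rightarrow> 'n operator) \<Rightarrow> 'n operator \<Rightarrow> 'n operator"
  where "adjoint_map P =
    (THE Q. \<forall>A B. trace (dag B ** P A) = trace (dag (Q B) ** A))"

definition tau_map :: "('n::finite operator \<Rightarrow> 'n operator) \<Rightarrow> 'n operator \<Rightarrow> 'n operator"
  where "tau_map P A = conj_op (adjoint_map P (conj_op A))"

text \<open>
  The first argument of the pairing is daggered here, whereas \<open>tau_map P (transpose V)\<close> is
  \<open>conj_op (adjoint_map P (dag V))\<close>. An equation on the latter therefore characterises membership
  of \<open>dag V\<close>, which differs from membership of \<open>V\<close> in general.
\<close>

definition dual_affine_set :: "'n::finite operator set \<Rightarrow> 'n operator set" where
  "dual_affine_set S = {V. \<forall>W\<in>S. trace (dag V ** W) = 1}"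

lemma vector_space_scale_op: "vector_space (scale_op :: complex \<Rightarrow> 'n::finite operator \<Rightarrow> _)"
  by unfold_locales (simp_all add: vec_eq_iff algebra_simps)

lemma trace_dag_mult:
  fixes A B :: "'n::finite operator"
  shows "trace (dag A ** B) = (\<Sum>i\<in>UNIV. \<Sum>j\<in>UNIV. cnj (A $ j $ i) * B $ j $ i)"
  by (simp add: trace_def matrix_matrix_mult_def)

lemma trace_dag_eq_zero:
  fixes A :: "'n::finite operator"
  assumes "\<And>B. trace (dag A ** B) = 0"
  shows "A = 0"
proof -
  have "trace (dag A ** A) = of_real (\<Sum>i\<in>UNIV. \<Sum>j\<in>UNIV. (cmod (A $ j $ i))\<^sup>2)"
    by (simp add: trace_dag_mult complex_norm_square mult.commute del: of_real_power)
  hence "(\<Sum>i\<in>UNIV. \<Sum>j\<in>UNIV. (cmod (A $ j $ i))\<^sup>2) = 0"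
    using assms[of A] by (metis of_real_eq_0_iff)
  thus ?thesis
    by (simp add: sum_nonneg_eq_0_iff sum_nonneg vec_eq_iff)
qed

lemma adjoint_map:
  fixes P :: "'n::finite operator \<Rightarrow> 'n operator"
  assumes "clinear_map P"
  shows "trace (dag B ** P A) = trace (dag (adjoint_map P B) ** A)"
proof -
  interpret P: Vector_Spaces.linear scale_op scale_op P by (rule assms)
  define E :: "'n \<Rightarrow> 'n \<Rightarrow> 'n operator"
    where "E k l = (\<chi> i j. if i = k \<and> j = l then 1 else 0)" for k l
  define Q where "Q B = (\<chi> k l. cnj (trace (dag B ** P (E k l))))" for B
  have dec: "A = (\<Sum>k\<in>UNIV. \<Sum>l\<in>UNIV. scale_op (A $ k $ l) (E k l))" for A
  proof -
    have "(\<Sum>k\<in>UNIV. \<Sum>l\<in>UNIV. A $ k $ l * E k l $ i $ j) = A $ i $ j" for i j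
    proof -
      have "(\<Sum>k\<in>UNIV. \<Sum>l\<in>UNIV. A $ k $ l * E k l $ i $ j)
          = (\<Sum>k\<in>UNIV. if k = i then \<Sum>l\<in>UNIV. if l = j then A $ k $ l else 0 else 0)"
        by (intro sum.cong refl) (auto simp: E_def if_distrib[of "\<lambda>x. _ * x"] cong: if_cong intro!: sum.neutral)
      thus ?thesis by simp
    qed
    thus ?thesis by (simp only: vec_eq_iff sum_component scale_op_nth) simp
  qed
  have lin: "trace (dag B ** sum f I) = (\<Sum>k\<in>I. trace (dag B ** f k))"
    for B :: "'n operator" and f and I :: "'n set"
    by (induction I rule: infinite_finite_induct) (simp_all add: trace_dag_mult sum.distrib algebra_simps trace_def[of 0])
  have sc: "trace (dag B ** scale_op c A) = c * trace (dag B ** A)" for B c and A :: "'n operator"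
    by (simp add: trace_dag_mult sum_distrib_left algebra_simps)
  have Q: "trace (dag B ** P A) = trace (dag (Q B) ** A)" for A B
  proof -
    have "trace (dag B ** P A)
        = (\<Sum>k\<in>UNIV. \<Sum>l\<in>UNIV. A $ k $ l * trace (dag B ** P (E k l)))"
      by (subst dec[of A]) (simp add: P.sum P.scale lin sc)
    also have "\<dots> = trace (dag (Q B) ** A)"
      unfolding trace_dag_mult[of "Q B"] by (subst sum.swap) (simp add: Q_def mult.commute)
    finally show ?thesis .
  qed
  have "R = Q" if R: "\<forall>A B. trace (dag B ** P A) = trace (dag (R B) ** A)" for R
  proof
    fix B
    have "trace (dag (R B - Q B) ** A) = 0" for A
      using R Q[of B A] by (simp add: trace_dag_mult sum_subtractf algebra_simps)
    thus "R B = Q B" using trace_dag_eq_zero[of "R B - Q B"] by simp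
  qed
  hence "adjoint_map P = Q" unfolding adjoint_map_def using Q by (intro the_equality) auto
  thus ?thesis using Q by simp
qed

end

theory Submission
  imports Defs
begin

text \<open>
  Testing against all \<open>A\<close>, the equation on \<open>\<tau>\<close>-maps says \<open>trace (W ** P A) = trace (P A) / \<gamma>\<close> for
  all \<open>A\<close>, i.e. the linear functional \<open>Y \<mapsto> trace (W ** Y) - trace Y / \<gamma>\<close> vanishes on the range
  of \<open>P\<close>. Membership of \<open>dag W\<close> in the dual set says it vanishes on the affine slice
  \<open>trace Y = \<gamma>\<close> of that range. The slice is nonempty and, as \<open>\<gamma> \<noteq> 0\<close>, misses the origin, so it
  spans the range. In the Hermitian-preserving case the slice is closed under \<open>dag\<close>, so its dual
  set is too.
\<close>

lemma dag_dag [simp]: "dag (dag A) = A"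
  by (simp add: vec_eq_iff)

lemma dag_mat_1 [simp]: "dag (mat 1) = mat 1"
  by (simp add: vec_eq_iff mat_def)

lemma trace_dag: "trace (dag A) = cnj (trace A)"
  by (simp add: trace_def)

lemma trace_scale_op: "trace (scale_op c A) = c * trace A"
  by (simp add: trace_def sum_distrib_left)

lemma trace_mult_scale_op: "trace (A ** scale_op c B) = c * trace (A ** B)"
  by (simp add: trace_def matrix_matrix_mult_def sum_distrib_left algebra_simps)

lemma trace_mult_dag: "trace (A ** dag B) = cnj (trace (dag A ** B))"
  unfolding trace_dag_mult
  by (subst sum.swap) (simp add: trace_def matrix_matrix_mult_def)

lemma conj_op_conj_op [simp]: "conj_op (conj_op A) = A"
  by (simp add: vec_eq_iff)

lemma conj_op_scale_op: "conj_op (scale_op c A) = scale_op (cnj c) (conj_op A)"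
  by (simp add: vec_eq_iff)

lemma conj_op_eq_iff: "conj_op A = B \<longleftrightarrow> A = conj_op B"
  by (metis conj_op_conj_op)

lemma conj_op_mat_1: "conj_op (mat 1) = mat 1"
  by (simp add: vec_eq_iff mat_def)

text \<open>Nondegeneracy of the Hilbert-Schmidt pairing, applied to \<open>A - B\<close>.\<close>

lemma operator_eqI:
  fixes A B :: "'n::finite operator"
  assumes "\<And>X. trace (dag A ** X) = trace (dag B ** X)"
  shows "A = B"
proof -
  have "trace (dag (A - B) ** X) = 0" for X
    using assms[of X] by (simp add: trace_dag_mult sum_subtractf algebra_simps)
  then show ?thesis
    using trace_dag_eq_zero[of "A - B"] by simp
qed

text \<open>Undoing the outer conjugation leaves an equation between values of
  \<open>adjoint_map P\<close>; pairing it with every \<open>A\<close> moves \<open>P\<close> onto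
  \<open>A\<close>.\<close>

lemma tau_map_transpose_eq_iff:
  fixes P :: "'n::finite operator \<Rightarrow> 'n operator"
  assumes "clinear_map P"
  shows "tau_map P (transpose W) = scale_op c (tau_map P (mat 1)) \<longleftrightarrow>
    (\<forall>A. trace (W ** P A) = c * trace (P A))" (is "?L \<longleftrightarrow> ?R")
proof -
  \<comment> \<open>The scalar is conjugated because \<open>tau_map\<close> ends in
    \<open>conj_op\<close>; the dagger in the pairing turns it back into \<open>c\<close>.\<close>
  define V where "V = scale_op (cnj c) (adjoint_map P (mat 1))"
  have W: "trace (dag (adjoint_map P (dag W)) ** A) = trace (W ** P A)" for A
    using adjoint_map[OF assms, of "dag W" A] by simp
  have "trace (dag V ** A) = c * trace (dag (adjoint_map P (mat 1)) ** A)" for A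
    by (simp add: V_def trace_dag_mult sum_distrib_left algebra_simps)
  then have V: "trace (dag V ** A) = c * trace (P A)" for A
    using adjoint_map[OF assms, of "mat 1" A] by simp
  have "?L \<longleftrightarrow> adjoint_map P (dag W) = V"
    by (simp add: tau_map_def V_def dag_def conj_op_mat_1 conj_op_eq_iff conj_op_scale_op)
  also have "\<dots> \<longleftrightarrow> ?R"
    by (metis W V operator_eqI)
  finally show ?thesis .
qed

lemma dag_in_dual_affine_set_iff:
  "dag W \<in> dual_affine_set S \<longleftrightarrow> (\<forall>X\<in>S. trace (W ** X) = 1)"
  by (simp add: dual_affine_set_def)

text \<open>Nonemptiness of \<open>S\<close> excludes the case where the trace vanishes on the range
  of \<open>P\<close>: every operator would then be dual, while the right side would force
  \<open>trace (W ** P A) = 0\<close>.\<close>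

lemma dual_affine_slice_iff:
  fixes P :: "'n::finite operator \<Rightarrow> 'n operator"
  assumes "clinear_map P" and idem: "\<And>A. P (P A) = P A" and \<gamma>: "\<gamma> \<noteq> 0"
    and S: "S = {X. P X = X \<and> trace X = \<gamma>}" and "S \<noteq> {}"
  shows "dag W \<in> dual_affine_set S \<longleftrightarrow> (\<forall>A. trace (W ** P A) = 1 / \<gamma> * trace (P A))"
    (is "?L \<longleftrightarrow> ?R")
proof
  interpret P: Vector_Spaces.linear scale_op scale_op P by (rule assms)
  assume L: ?L
  obtain X where X: "P X = X" "trace X = \<gamma>" "X \<in> S"
    using \<open>S \<noteq> {}\<close> S by blast
  show ?R
  proof
    fix A
    \<comment> \<open>Chosen so that adding \<open>c\<close> times \<open>X\<close> corrects the
      trace of \<open>P A\<close> to \<open>\<gamma>\<close>; pairing the sum with \<open>W\<close>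
      then gives \<open>trace (W ** P A) = 1 - c\<close>.\<close>
    define c where "c = 1 - trace (P A) / \<gamma>"
    have "P A + scale_op c X \<in> S"
      using \<gamma> by (simp add: S P.add P.scale idem X trace_add trace_scale_op c_def field_simps)
    then have "trace (W ** (P A + scale_op c X)) = 1"
      using L unfolding dag_in_dual_affine_set_iff by blast
    moreover have "trace (W ** X) = 1"
      using L X(3) unfolding dag_in_dual_affine_set_iff by blast
    ultimately show "trace (W ** P A) = 1 / \<gamma> * trace (P A)"
      by (simp add: matrix_add_ldistrib trace_add trace_mult_scale_op c_def)
  qed
next
  assume R: ?R
  show ?L
    unfolding dag_in_dual_affine_set_iff
  proof
    fix X assume "X \<in> S"
    then show "trace (W ** X) = 1"
      using R[rule_format, of X] S \<gamma> by simp
  qed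
qed

text \<open>The pairings of \<open>W\<close> with \<open>X\<close> and of \<open>dag W\<close> with
  \<open>dag X\<close> are complex conjugates, and the required value 1 is real.\<close>

lemma dag_in_dual_affine_set_if_closed:
  assumes closed: "\<And>X. X \<in> S \<Longrightarrow> dag X \<in> S" and W: "W \<in> dual_affine_set S"
  shows "dag W \<in> dual_affine_set S"
  unfolding dag_in_dual_affine_set_iff
proof
  fix X assume "X \<in> S"
  then have "trace (dag W ** dag X) = 1"
    using closed W by (simp add: dual_affine_set_def)
  then show "trace (W ** X) = 1"
    by (simp add: trace_mult_dag)
qed

theorem theorem7:
  fixes P :: "'n::finite operator \<Rightarrow> 'n operator"
    and \<gamma> :: complex
    and S :: "'n operator set"
    and W :: "'n operator"
  assumes "clinear_map P"
    and "\<And>A. P (P A) = P A"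
    and "\<gamma> \<noteq> 0"
    and "S = {X. P X = X \<and> trace X = \<gamma>}"
    and "S \<noteq> {}"
  shows "(dag W \<in> dual_affine_set S \<longleftrightarrow>
            tau_map P (transpose W) = scale_op (1 / \<gamma>) (tau_map P (mat 1))) \<and>
         (dag W = W \<or> (hermitian_preserving P \<and> \<gamma> \<in> \<real>) \<longrightarrow>
            (W \<in> dual_affine_set S \<longleftrightarrow>
               tau_map P (transpose W) = scale_op (1 / \<gamma>) (tau_map P (mat 1))))"
proof -
  have *: "dag W \<in> dual_affine_set S \<longleftrightarrow>
      tau_map P (transpose W) = scale_op (1 / \<gamma>) (tau_map P (mat 1))"
    unfolding tau_map_transpose_eq_iff[OF assms(1)] using assms by (rule dual_affine_slice_iff)
  have "W \<in> dual_affine_set S \<longleftrightarrow> dag W \<in> dual_affine_set S"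
    if "dag W = W \<or> (hermitian_preserving P \<and> \<gamma> \<in> \<real>)"
    using that
  proof
    assume "hermitian_preserving P \<and> \<gamma> \<in> \<real>"
    \<comment> \<open>The trace of \<open>dag X\<close> is the conjugate of \<open>\<gamma>\<close>,
      hence \<open>\<gamma>\<close> itself as it is real.\<close>
    then have "dag X \<in> S" if "X \<in> S" for X
      using that by (simp add: assms(4) hermitian_preserving_def trace_dag Reals_cnj_iff)
    then show ?thesis
      by (metis dag_in_dual_affine_set_if_closed dag_dag)
  qed simp
  with * show ?thesis by blast
qed

end
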